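(* Let $\mathcal{A}\in\mathbb{C}^{I_1\times\cdots\times I_M\times J_1\times\cdots\times J_N}$ and $\mathcal{B}\in\mathbb{C}^{J_1\times\cdots\times J_N\times K_1\times\cdots\times K_L}$. Let $\mathcal{M}\in\mathbb{C}^{I_1\times\cdots\times I_M\times I_1\times\cdots\times I_M}$, $\mathcal{N}\in\mathbb{C}^{J_1\times\cdots\times J_N\times J_1\times\cdots\times J_N}$ and $\mathcal{L}\in\mathbb{C}^{K_1\times\cdots\times K_L\times K_1\times\cdots\times K_L}$ be Hermitian positive definite tensors. Then $(\mathcal{A}*_N\mathcal{B})^{\dagger}_{\mathcal{M}\mathcal{L}}=\mathcal{B}^{\dagger}_{\mathcal{N}\mathcal{L}}*_N\mathcal{A}^{\dagger}_{\mathcal{M}\mathcal{N}}$ if and only if both of the following hold: (i) $\mathcal{A}^{\dagger}_{\mathcal{M}\mathcal{N}}*_M\mathcal{A}*_N\mathcal{B}*_L\mathcal{B}^{\#}_{\mathcal{N}\mathcal{L}}*_N\mathcal{A}^{\#}_{\mathcal{M}\mathcal{N}}=\mathcal{B}*_L\mathcal{B}^{\#}_{\mathcal{N}\mathcal{L}}*_N\mathcal{A}^{\#}_{\mathcal{M}\mathcal{N}}$; (ii) $(\mathcal{M}*_M\mathcal{A}*_N\mathcal{B}*_L\mathcal{B}^{\dagger}_{\mathcal{N}\mathcal{L}}*_N\mathcal{A}^{\dagger}_{\mathcal{M}\mathcal{N}})^H=\mathcal{M}*_M\mathcal{A}*_N\mathcal{B}*_L\mathcal{B}^{\dagger}_{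\mathcal{N}\mathcal{L}}*_N\mathcal{A}^{\dagger}_{\mathcal{M}\mathcal{N}}$.
   Context: For $\mathcal{A}\in\mathbb{C}^{I_1\times\cdots\times I_M\times J_1\times\cdots\times J_N}$ and $\mathcal{B}\in\mathbb{C}^{J_1\times\cdots\times J_N\times K_1\times\cdots\times K_L}$ the Einstein product $*_N$ (contracting $N$ indices) is $(\mathcal{A}*_N\mathcal{B})_{i_1\cdots i_Mk_1\cdots k_L}=\sum_{j_1,\dots,j_N}a_{i_1\cdots i_Mj_1\cdots j_N}b_{j_1\cdots j_Nk_1\cdots k_L}$; $*_M,*_L,*_K$ are defined likewise. The conjugate transpose is $(\mathcal{A}^H)_{j_1\cdots j_Ni_1\cdots i_M}=\overline{a_{i_1\cdots i_Mj_1\cdots j_N}}$. In $\mathbb{C}^{I_1\times\cdots\times I_K\times I_1\times\cdots\times I_K}$: the identity tensor $\mathcal{I}$ has entries $\prod_k\delta_{i_kj_k}$; $\mathcal{U}$ is unitary if $\mathcal{U}*_K\mathcal{U}^H=\mathcal{U}^H*_K\mathcal{U}=\mathcal{I}$; $\mathcal{D}$ is diagonal if $d_{i_1\cdots i_Kj_1\cdots j_K}=0$ whenever $(i_1,\dots,i_K)\ne(j_1,\dots,j_K)$; $\mathcal{P}$ is Hermitian positive definite if $\mathcal{P}=\mathcal{U}*_K\mathcal{D}*_K\mathcal{U}^H$ with $\mathcal{U}$ unitary and $\mathcal{D}$ diagonal with positive diagonal entries; $\mathcal{P}^{-1}$ is the inverse with respect to $*_K$. For any $\mathcal{A}\in\mathbb{C}^{I_1\times\cdots\times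 I_M\times J_1\times\cdots\times J_N}$ and Hermitian positive definite $\mathcal{S}\in\mathbb{C}^{I_1\times\cdots\times I_M\times I_1\times\cdots\times I_M}$, $\mathcal{T}\in\mathbb{C}^{J_1\times\cdots\times J_N\times J_1\times\cdots\times J_N}$: the weighted conjugate transpose is $\mathcal{A}^{\#}_{\mathcal{S}\mathcal{T}}=\mathcal{T}^{-1}*_N\mathcal{A}^H*_M\mathcal{S}$, and the weighted Moore--Penrose inverse $\mathcal{A}^{\dagger}_{\mathcal{S}\mathcal{T}}$ is the unique $\mathcal{X}\in\mathbb{C}^{J_1\times\cdots\times J_N\times I_1\times\cdots\times I_M}$ satisfying $\mathcal{A}*_N\mathcal{X}*_M\mathcal{A}=\mathcal{A}$, $\mathcal{X}*_M\mathcal{A}*_N\mathcal{X}=\mathcal{X}$, $(\mathcal{S}*_M\mathcal{A}*_N\mathcal{X})^H=\mathcal{S}*_M\mathcal{A}*_N\mathcal{X}$, $(\mathcal{T}*_N\mathcal{X}*_M\mathcal{A})^H=\mathcal{T}*_N\mathcal{X}*_M\mathcal{A}$. *)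

theory Defs
  imports Complex_Main "HOL-Library.FuncSet"
begin

text \<open>A complex tensor carries its list of dimensions \<open>[I\<^sub>1, \<dots>, I\<^sub>K]\<close>; its entries are
  addressed by lists \<open>[i\<^sub>1, \<dots>, i\<^sub>K]\<close> with zero-based components \<open>i\<^sub>k < I\<^sub>k\<close>.\<close>

definition multi_indices :: "nat list \<Rightarrow> nat list set" where
  "multi_indices ds = {i. list_all2 (<) i ds}"

typedef ctensor =
  "{(ds :: nat list, f :: nat list \<Rightarrow> complex). f \<in> extensional (multi_indices ds)}"
  by (rule exI[of _ "([], restrict (\<lambda>_. 0) (multi_indices []))"]) auto

definition dims :: "ctensor \<Rightarrow> nat list" where
  "dims A = fst (Rep_ctensor A)"

definition entry :: "ctensor \<Rightarrow> nat list \<Rightarrow> complex" (infixl "$$" 100) where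
  "A $$ i = snd (Rep_ctensor A) i"

definition mk_tensor :: "nat list \<Rightarrow> (nat list \<Rightarrow> complex) \<Rightarrow> ctensor" where
  "mk_tensor ds f = Abs_ctensor (ds, restrict f (multi_indices ds))"

definition tensors :: "nat list \<Rightarrow> ctensor set" where
  "tensors ds = {A. dims A = ds}"

lemma dims_mk_tensor [simp]: "dims (mk_tensor ds f) = ds"
  by (simp add: dims_def mk_tensor_def Abs_ctensor_inverse)

lemma entry_mk_tensor [simp]: "i \<in> multi_indices ds \<Longrightarrow> mk_tensor ds f $$ i = f i"
  by (simp add: entry_def mk_tensor_def Abs_ctensor_inverse)

lemma ctensor_eqI:
  assumes "dims A = dims B" and "\<And>i. i \<in> multi_indices (dims A) \<Longrightarrow> A $$ i = B $$ i"
  shows "A = B"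
proof -
  have "snd (Rep_ctensor A) \<in> extensional (multi_indices (dims A))" 
    "snd (Rep_ctensor B) \<in> extensional (multi_indices (dims A))"
    using Rep_ctensor[of A] Rep_ctensor[of B] assms(1) by (auto simp: dims_def case_prod_beta)
  then have "snd (Rep_ctensor A) = snd (Rep_ctensor B)"
    using assms(2) by (auto simp: entry_def intro: extensionalityI)
  then have "Rep_ctensor A = Rep_ctensor B"
    using assms(1) by (simp add: dims_def prod_eq_iff)
  then show ?thesis by (simp add: Rep_ctensor_inject)
qed

text \<open>The Einstein product contracts the last \<open>n\<close> indices of \<open>A\<close> with the first \<open>n\<close> indices
  of \<open>B\<close>; it is meaningful when the corresponding dimensions agree.\<close>

definition einstein :: "ctensor \<Rightarrow> nat \<Rightarrow> ctensor \<Rightarrow> ctensor"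
    ("(_ \<star>\<^bsub>_\<^esub> _)" [70, 0, 71] 70) where
  "A \<star>\<^bsub>n\<^esub> B =
     (let m = length (dims A) - n; Is = take m (dims A); Js = drop m (dims A); Ks = drop n (dims B)
      in mk_tensor (Is @ Ks)
           (\<lambda>x. \<Sum>j \<in> multi_indices Js. A $$ (take m x @ j) * B $$ (j @ drop m x)))"

text \<open>The conjugate transpose depends on how the indices are split into row and column indices:
  \<open>conj_transpose m A\<close> takes the first \<open>m\<close> indices of \<open>A\<close> as row indices.\<close>

definition conj_transpose :: "nat \<Rightarrow> ctensor \<Rightarrow> ctensor" where
  "conj_transpose m A =
     (let n = length (dims A) - m
      in mk_tensor (drop m (dims A) @ take m (dims A)) (\<lambda>x. cnj (A $$ (drop n x @ take n x))))"

lemma multi_indices_append_iff: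
  "length i = length Is \<Longrightarrow>
     i @ j \<in> multi_indices (Is @ Js) \<longleftrightarrow> i \<in> multi_indices Is \<and> j \<in> multi_indices Js"
  by (simp add: multi_indices_def list_all2_append)

lemma length_multi_indices: "i \<in> multi_indices ds \<Longrightarrow> length i = length ds"
  by (simp add: multi_indices_def list_all2_lengthD)

lemma einstein_entry:
  assumes "A \<in> tensors (Is @ Js)" and "B \<in> tensors (Js @ Ks)"
    and "i \<in> multi_indices Is" and "k \<in> multi_indices Ks"
  shows "(A \<star>\<^bsub>length Js\<^esub> B) $$ (i @ k) = (\<Sum>j \<in> multi_indices Js. A $$ (i @ j) * B $$ (j @ k))"
  using assms
  by (simp add: einstein_def tensors_def Let_def multi_indices_append_iff length_multi_indices)

lemma einstein_in_tensors:
  assumes "A \<in> tensors (Is @ Js)" and "B \<in> tensors (Js @ Ks)"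
  shows "A \<star>\<^bsub>length Js\<^esub> B \<in> tensors (Is @ Ks)"
  using assms by (simp add: einstein_def tensors_def Let_def)

lemma conj_transpose_entry:
  assumes "A \<in> tensors (Is @ Js)" and "i \<in> multi_indices Is" and "j \<in> multi_indices Js"
  shows "conj_transpose (length Is) A $$ (j @ i) = cnj (A $$ (i @ j))"
  using assms
  by (simp add: conj_transpose_def tensors_def Let_def multi_indices_append_iff length_multi_indices)

lemma conj_transpose_in_tensors:
  "A \<in> tensors (Is @ Js) \<Longrightarrow> conj_transpose (length Is) A \<in> tensors (Js @ Is)"
  by (simp add: conj_transpose_def tensors_def Let_def)

definition identity_tensor :: "nat list \<Rightarrow> ctensor" where
  "identity_tensor Is =
     mk_tensor (Is @ Is)
       (\<lambda>x. \<Prod>k < length Is. if x ! k = x ! (length Is + k) then 1 else 0)"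

definition unitary_tensor :: "nat list \<Rightarrow> ctensor \<Rightarrow> bool" where
  "unitary_tensor Is U \<longleftrightarrow>
     U \<in> tensors (Is @ Is) \<and>
     U \<star>\<^bsub>length Is\<^esub> conj_transpose (length Is) U = identity_tensor Is \<and>
     conj_transpose (length Is) U \<star>\<^bsub>length Is\<^esub> U = identity_tensor Is"

definition diagonal_tensor :: "nat list \<Rightarrow> ctensor \<Rightarrow> bool" where
  "diagonal_tensor Is D \<longleftrightarrow>
     D \<in> tensors (Is @ Is) \<and>
     (\<forall>i \<in> multi_indices Is. \<forall>j \<in> multi_indices Is. i \<noteq> j \<longrightarrow> D $$ (i @ j) = 0)"

definition hermitian_pos_def :: "nat list \<Rightarrow> ctensor \<Rightarrow> bool" where
  "hermitian_pos_def Is P \<longleftrightarrow>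
     (\<exists>U D. unitary_tensor Is U \<and> diagonal_tensor Is D \<and>
        (\<forall>i \<in> multi_indices Is. D $$ (i @ i) \<in> \<real> \<and> 0 < Re (D $$ (i @ i))) \<and>
        P = U \<star>\<^bsub>length Is\<^esub> D \<star>\<^bsub>length Is\<^esub> conj_transpose (length Is) U)"

definition tensor_inverse :: "nat list \<Rightarrow> ctensor \<Rightarrow> ctensor" where
  "tensor_inverse Is P =
     (THE Q. Q \<in> tensors (Is @ Is) \<and>
        P \<star>\<^bsub>length Is\<^esub> Q = identity_tensor Is \<and> Q \<star>\<^bsub>length Is\<^esub> P = identity_tensor Is)"

text \<open>In the following, \<open>A \<in> tensors (Is @ Js)\<close> and the weights \<open>S\<close>, \<open>T\<close> are Hermitian positive
  definite tensors in \<open>tensors (Is @ Is)\<close> and \<open>tensors (Js @ Js)\<close>.\<close>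

definition weighted_conj_transpose ::
    "nat list \<Rightarrow> nat list \<Rightarrow> ctensor \<Rightarrow> ctensor \<Rightarrow> ctensor \<Rightarrow> ctensor" where
  "weighted_conj_transpose Is Js S T A =
     tensor_inverse Js T \<star>\<^bsub>length Js\<^esub> conj_transpose (length Is) A \<star>\<^bsub>length Is\<^esub> S"

definition is_weighted_mp_inverse ::
    "nat list \<Rightarrow> nat list \<Rightarrow> ctensor \<Rightarrow> ctensor \<Rightarrow> ctensor \<Rightarrow> ctensor \<Rightarrow> bool" where
  "is_weighted_mp_inverse Is Js S T A X \<longleftrightarrow>
     (let m = length Is; n = length Js in
        X \<in> tensors (Js @ Is) \<and>
        A \<star>\<^bsub>n\<^esub> X \<star>\<^bsub>m\<^esub> A = A \<and>
        X \<star>\<^bsub>m\<^esub> A \<star>\<^bsub>n\<^esub> X = X \<and>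
        conj_transpose m (S \<star>\<^bsub>m\<^esub> A \<star>\<^bsub>n\<^esub> X) = S \<star>\<^bsub>m\<^esub> A \<star>\<^bsub>n\<^esub> X \<and>
        conj_transpose n (T \<star>\<^bsub>n\<^esub> X \<star>\<^bsub>m\<^esub> A) = T \<star>\<^bsub>n\<^esub> X \<star>\<^bsub>m\<^esub> A)"

definition weighted_mp_inverse ::
    "nat list \<Rightarrow> nat list \<Rightarrow> ctensor \<Rightarrow> ctensor \<Rightarrow> ctensor \<Rightarrow> ctensor" where
  "weighted_mp_inverse Is Js S T A = (THE X. is_weighted_mp_inverse Is Js S T A X)"

end

theory Submission
  imports Defs
begin

text \<open>Unfolding the two groups of indices turns Einstein products into matrix products, and
  matrices with finite support form a von Neumann regular ring whose involution is proper
  (\<open>x\<^sup>* x = 0\<close> implies \<open>x = 0\<close>). In such a ring every \<open>a\<close> has a unique Moore--Penrose inverse,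
  obtained from inner inverses of \<open>a\<^sup>* a\<close> and \<open>a a\<^sup>*\<close>. For the unweighted law let \<open>x\<close>, \<open>y\<close> be the
  Moore--Penrose inverses of \<open>a\<close>, \<open>b\<close>, with projections \<open>p = x a\<close>, \<open>q = b y\<close>, and put
  \<open>s = b b\<^sup>*\<close>: condition (i) says that \<open>p\<close> commutes with \<open>s\<close>. It implies \<open>p q = q p\<close>, from which the
  Penrose equations other than (ii) follow. Conversely, if \<open>y x\<close> is the Moore--Penrose inverse of
  \<open>a b\<close>, then \<open>p q\<close> is idempotent, hence \<open>p q = q p\<close> because the involution is proper, and the
  fourth Penrose equation gives \<open>p s = s p\<close>. A positive definite weight factors as \<open>r\<^sup>* r\<close> with
  invertible \<open>r\<close>, and conjugating with these factors reduces the weighted law to the unweighted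
  one.\<close>

section \<open>Moore--Penrose inverses in regular rings with proper involution\<close>

text \<open>The base class is \<open>ring\<close>, without a unit, because finitely supported
  matrices of all shapes together have no common unit when there are infinitely many
  indices.\<close>

class regular_star_ring = ring +
  fixes adj :: "'a \<Rightarrow> 'a"
  assumes adj_diff: "adj (x - y) = adj x - adj y"
    and adj_mult: "adj (x * y) = adj y * adj x"
    and adj_adj [simp]: "adj (adj x) = x"
    and adj_mult_self_eq_0D: "adj x * x = 0 \<Longrightarrow> x = 0"
    and ex_inner_inverse: "\<exists>g. x * g * x = x"
begin

definition is_mp_inverse :: "'a \<Rightarrow> 'a \<Rightarrow> bool" where
  "is_mp_inverse a x \<longleftrightarrow>
     a * x * a = a \<and> x * a * x = x \<and> adj (a * x) = a * x \<and> adj (x * a) = x * a"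

text \<open>The self-adjoint projections \<open>a * x\<close> and \<open>a * y\<close> absorb each
  other, so taking adjoints identifies them; likewise \<open>x * a\<close> and \<open>y * a\<close>.
  Then \<open>x = x * a * x = x * a * y = y * a * y = y\<close>.\<close>

lemma is_mp_inverse_unique:
  assumes "is_mp_inverse a x" "is_mp_inverse a y"
  shows "x = y"
proof -
  have x: "a * x * a = a" "x * a * x = x" "adj (a * x) = a * x" "adj (x * a) = x * a"
    and y: "a * y * a = a" "y * a * y = y" "adj (a * y) = a * y" "adj (y * a) = y * a"
    using assms by (simp_all add: is_mp_inverse_def)
  have "a * x = adj ((a * y) * (a * x))"
    using x y by (simp add: mult.assoc[symmetric])
  also have "\<dots> = (a * x) * (a * y)"
    using x y by (simp only: adj_mult[of "a * y"])
  also have "\<dots> = a * y"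
    using x by (simp add: mult.assoc[symmetric])
  finally have ax: "a * x = a * y" .
  have "x * a = adj ((x * a) * (y * a))"
    using x y by (simp add: mult.assoc)
  also have "\<dots> = (y * a) * (x * a)"
    using x y by (simp only: adj_mult[of "x * a"])
  also have "\<dots> = y * a"
    using x by (simp add: mult.assoc)
  finally have xa: "x * a = y * a" .
  have "x = x * (a * x)" using x by (simp add: mult.assoc)
  also have "\<dots> = (x * a) * y" using ax by (simp add: mult.assoc)
  also have "\<dots> = y" using xa y by simp
  finally show ?thesis .
qed

text \<open>Properness of the involution, applied to the difference
  \<open>a * x - a\<close>.\<close>

lemma adj_cancel:
  assumes "adj a * a * x = adj a * a"
  shows "a * x = a"
proof -
  have "adj (a * x - a) * (a * x - a)
      = adj x * (adj a * a * x - adj a * a) - (adj a * a * x - adj a * a)"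
    by (simp add: adj_diff adj_mult algebra_simps)
  also have "\<dots> = 0" by (simp add: assms)
  finally have "a * x - a = 0" by (rule adj_mult_self_eq_0D)
  then show ?thesis by simp
qed

text \<open>For an inner inverse \<open>g\<close> of \<open>adj a * a\<close>, the witness is
  \<open>g * adj a\<close>: cancelling \<open>adj a\<close> gives
  \<open>a * g * adj a * a = a\<close>. The adjoint of this equation rewrites
  \<open>c = a * g * adj a\<close> as \<open>c * adj c\<close>, which is self-adjoint.\<close>

lemma ex_13_inverse: "\<exists>x. a * x * a = a \<and> adj (a * x) = a * x"
proof -
  obtain g where g: "adj a * a * g * (adj a * a) = adj a * a"
    using ex_inner_inverse by blast
  have e: "a * (g * (adj a * a)) = a"
    by (rule adj_cancel) (use g in \<open>simp add: mult.assoc\<close>)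
  have e': "adj a * (a * (adj g * adj a)) = adj a"
    using arg_cong[OF e, of adj] by (simp add: adj_mult mult.assoc)
  have sa: "a * (g * adj a) = a * g * (adj a * a) * adj g * adj a"
    by (simp add: e' mult.assoc)
  have "adj (a * (g * adj a)) = a * (g * adj a)"
    unfolding sa by (simp add: adj_mult mult.assoc)
  then show ?thesis
    using e by (intro exI[of _ "g * adj a"]) (simp add: mult.assoc)
qed

text \<open>Here \<open>x\<close> makes \<open>a * x\<close> self-adjoint and \<open>y\<close>,
  obtained from \<open>adj a\<close>, makes \<open>y * a\<close> self-adjoint. The product
  \<open>y * a * x\<close> inherits both properties.\<close>

lemma ex_mp_inverse: "\<exists>x. is_mp_inverse a x"
proof -
  obtain x where x: "a * x * a = a" "adj (a * x) = a * x"
    using ex_13_inverse by blast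
  obtain y' where y': "adj a * y' * adj a = adj a" "adj (adj a * y') = adj a * y'"
    using ex_13_inverse by blast
  define y where "y = adj y'"
  have y: "a * y * a = a" "adj (y * a) = y * a"
    using arg_cong[OF y'(1), of adj] y'(2) by (simp_all add: y_def adj_mult mult.assoc)
  have 1: "a * (y * a * x) = a * x"
    using y(1) by (simp add: mult.assoc[symmetric])
  have 2: "y * a * x * a = y * a"
    using x(1) by (simp add: mult.assoc)
  have 3: "y * a * (y * a * x) = y * a * x"
    using y(1) by (simp add: mult.assoc[of y]) (simp add: mult.assoc[symmetric])
  have "is_mp_inverse a (y * a * x)"
    unfolding is_mp_inverse_def 1 2 3 using x y by simp
  then show ?thesis by blast
qed

text \<open>With \<open>d = p * q - q * p * q\<close>, all four terms of \<open>adj d * d\<close>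
  reduce to \<open>q * p * q\<close> and cancel. So \<open>p * q\<close> equals the self-adjoint
  \<open>q * p * q\<close>, and its adjoint is \<open>q * p\<close>.\<close>

lemma idempotent_mult_projections:
  assumes "adj p = p" "p * p = p" "adj q = q" "q * q = q" "p * q * (p * q) = p * q"
  shows "p * q = q * p"
proof -
  have qq: "q * (q * z) = q * z" and pp: "p * (p * z) = p * z"
    and pqpq: "p * (q * (p * q)) = p * q" for z
    using assms by (simp_all add: mult.assoc[symmetric])
  have "adj (p * q - q * p * q) * (p * q - q * p * q) = 0"
    by (simp add: adj_diff adj_mult assms(1,3) algebra_simps qq pp pqpq)
  then have "p * q - q * p * q = 0"
    by (rule adj_mult_self_eq_0D)
  then have pq: "p * q = q * p * q"
    by simp
  then have "adj (p * q) = p * q"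
    by (metis adj_mult assms(1,3) mult.assoc)
  then show ?thesis
    by (simp add: adj_mult assms(1,3))
qed

theorem reverse_order_law:
  assumes "is_mp_inverse a x" "is_mp_inverse b y"
  shows "is_mp_inverse (a * b) (y * x) \<longleftrightarrow>
    x * a * b * adj b * adj a = b * adj b * adj a \<and> adj (a * b * y * x) = a * b * y * x"
proof -
  define p q s where "p = x * a" and "q = b * y" and "s = b * adj b"
  have a: "a * x * a = a" "x * a * x = x" "adj (x * a) = x * a"
    and b: "b * y * b = b" "y * b * y = y" "adj (b * y) = b * y" "adj (y * b) = y * b"
    using assms by (simp_all add: is_mp_inverse_def)
  have p: "adj p = p" "p * p = p" "a * p = a" "p * x = x"
    using a by (simp_all add: p_def mult.assoc[symmetric])
  have pa: "p * adj a = adj a"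
    using arg_cong[OF p(3), of adj] p(1) by (simp add: adj_mult)
  have q: "adj q = q" "q * q = q" "q * b = b" "y * q = y"
    using b by (simp_all add: q_def mult.assoc[symmetric])
  have s: "adj s = s" "q * s = s"
    using q by (simp_all add: s_def adj_mult mult.assoc[symmetric])
  have sq: "s * q = s"
    using arg_cong[OF s(2), of adj] q(1) s(1) by (simp add: adj_mult)
  have ys: "y * s = adj b"
    using arg_cong[OF b(1), of adj] b(4) by (simp add: s_def adj_mult[of b] mult.assoc)
  \<comment> \<open>This gives \<open>q = s * adj y * y\<close>, so statements about
    \<open>s\<close> pass to \<open>q\<close>.\<close>
  have y: "adj b * (adj y * y) = y"
    using b by (simp add: adj_mult[symmetric] mult.assoc[symmetric])
  show ?thesis
  proof
    assume "is_mp_inverse (a * b) (y * x)"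
    then have 1: "a * b * (y * x) * (a * b) = a * b"
      and 3: "adj (a * b * (y * x)) = a * b * (y * x)"
      and 4: "adj (y * x * (a * b)) = y * x * (a * b)"
      unfolding is_mp_inverse_def by auto
    \<comment> \<open>The first Penrose equation between \<open>x\<close> and \<open>y\<close> says
      that \<open>p * q\<close> is idempotent.\<close>
    have "x * (a * b * (y * x) * (a * b)) * y = x * (a * b) * y" using 1 by simp
    then have "p * q * (p * q) = p * q" by (simp add: p_def q_def mult.assoc)
    then have pq: "p * q = q * p"
      by (rule idempotent_mult_projections[OF p(1,2) q(1,2)])
    have "y * x * (a * b) = y * p * b"
      by (simp add: p_def mult.assoc)
    then have "adj b * p * adj y = y * p * b"
      using 4 by (simp add: adj_mult p(1) mult.assoc)
    \<comment> \<open>Multiplying by \<open>b\<close> and \<open>adj b\<close> turns the fourth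
      Penrose equation into \<open>s * p * q = q * p * s\<close>, where \<open>q\<close> can then be
      absorbed into \<open>s\<close>.\<close>
    then have "b * (adj b * p * adj y) * adj b = b * (y * p * b) * adj b"
      by simp
    moreover have "adj y * adj b = q"
      using q(1) by (simp add: q_def adj_mult)
    ultimately have "s * p * q = q * p * s"
      by (simp add: s_def q_def mult.assoc)
    moreover have "s * p * q = s * q * p"
      by (simp add: pq mult.assoc)
    moreover have "q * p * s = p * (q * s)"
      by (simp add: pq[symmetric] mult.assoc)
    ultimately have "p * s = s * p"
      using s(2) sq by simp
    then have "p * s * adj a = s * adj a"
      using pa by (simp add: mult.assoc)
    then show "x * a * b * adj b * adj a = b * adj b * adj a \<and> adj (a * b * y * x) = a * b * y * x"
      using 3 by (simp add: p_def s_def mult.assoc)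
  next
    assume "x * a * b * adj b * adj a = b * adj b * adj a \<and> adj (a * b * y * x) = a * b * y * x"
    then have i: "p * s * adj a = s * adj a" and ii: "adj (a * b * y * x) = a * b * y * x"
      by (simp_all add: p_def s_def mult.assoc)
    \<comment> \<open>Multiplying (i) by \<open>adj x\<close> on the right replaces
      \<open>adj a\<close> by \<open>p\<close>. Since \<open>p * s * p\<close> is self-adjoint,
      \<open>s * p\<close> equals its own adjoint \<open>p * s\<close>.\<close>
    have "p * s * p = s * p"
      using arg_cong[OF i, of "\<lambda>z. z * adj x"] p(1) by (simp add: p_def adj_mult mult.assoc)
    moreover from arg_cong[OF this, of adj] have "p * s * p = p * s"
      using p(1) s(1) by (simp add: adj_mult mult.assoc)
    ultimately have ps: "p * s = s * p"
      by simp
    have qps: "q * (p * s) = p * s"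
      using s(2) by (simp add: ps mult.assoc[symmetric])
    \<comment> \<open>Since \<open>q\<close> fixes \<open>p * s\<close> from the left, it also fixes
      \<open>p * q\<close>, a right multiple of \<open>p * s\<close>.\<close>
    have "p * q = p * s * adj y * y"
      by (simp add: q_def s_def y mult.assoc)
    also have "\<dots> = q * (p * s * adj y * y)"
      using qps by (simp add: mult.assoc[symmetric])
    also have "\<dots> = q * (p * q)"
      by (simp add: q_def s_def y mult.assoc)
    finally have pqp: "p * q = q * p * q" by (simp add: mult.assoc)
    have "q * p = adj (p * q)"
      by (simp add: adj_mult p(1) q(1))
    also have "\<dots> = adj (q * p * q)"
      by (rule arg_cong[OF pqp])
    also have "\<dots> = q * p * q"
      by (simp add: adj_mult p(1) q(1) mult.assoc)
    finally have pq: "p * q = q * p"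
      using pqp by (rule trans[OF _ sym, THEN sym])
    have 1: "a * b * (y * x) * (a * b) = a * b"
    proof -
      have "a * b * (y * x) * (a * b) = a * (q * p) * b" by (simp add: p_def q_def mult.assoc)
      also have "\<dots> = (a * p) * (q * b)" unfolding pq[symmetric] by (simp add: mult.assoc)
      also have "\<dots> = a * b" using p q by simp
      finally show ?thesis .
    qed
    have 2: "y * x * (a * b) * (y * x) = y * x"
    proof -
      have "y * x * (a * b) * (y * x) = y * (p * q) * x" by (simp add: p_def q_def mult.assoc)
      also have "\<dots> = (y * q) * (p * x)" unfolding pq by (simp add: mult.assoc)
      also have "\<dots> = y * x" using p q by simp
      finally show ?thesis .
    qed
    have 4: "adj (y * x * (a * b)) = y * x * (a * b)"
    proof -
      have "y * x * (a * b) = y * p * b"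
        by (simp add: p_def mult.assoc)
      \<comment> \<open>Inserting the self-adjoint \<open>y * b\<close> produces a factor
        \<open>s\<close>; moving \<open>p\<close> past \<open>s\<close> then yields the adjoint of
        \<open>y * p * b\<close>.\<close>
      also have "\<dots> = y * p * (b * (y * b))"
        using b(1) by (simp add: mult.assoc)
      also have "\<dots> = y * p * (b * adj b * adj y)"
        by (subst b(4)[symmetric]) (simp add: adj_mult mult.assoc)
      also have "\<dots> = y * (p * s) * adj y"
        by (simp add: s_def mult.assoc)
      also have "\<dots> = y * s * p * adj y"
        by (simp add: ps mult.assoc)
      also have "\<dots> = adj b * p * adj y"
        using ys by simp
      finally have eq: "y * x * (a * b) = adj b * p * adj y" .
      then have "adj (y * x * (a * b)) = y * p * b"
        by (simp add: adj_mult p(1) mult.assoc)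
      then show ?thesis
        by (simp add: p_def mult.assoc)
    qed
    show "is_mp_inverse (a * b) (y * x)"
      using 1 2 4 ii by (simp add: is_mp_inverse_def mult.assoc)
  qed
qed

section \<open>Weighted inverses by conjugation\<close>

definition is_mp_inverse_wrt :: "'a \<Rightarrow> 'a \<Rightarrow> 'a \<Rightarrow> 'a \<Rightarrow> bool" where
  "is_mp_inverse_wrt s t a x \<longleftrightarrow>
     a * x * a = a \<and> x * a * x = x \<and> adj (s * a * x) = s * a * x \<and> adj (t * x * a) = t * x * a"

text \<open>Invertibility in the corner \<open>e R e\<close> of the non-unital ring
  \<open>R\<close>, whose unit is the self-adjoint idempotent \<open>e\<close>. Each tensor shape
  later contributes its own unit.\<close>

definition local_inverse :: "'a \<Rightarrow> 'a \<Rightarrow> 'a \<Rightarrow> bool" where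
  "local_inverse e r r' \<longleftrightarrow> adj e = e \<and> r * r' = e \<and> r' * r = e \<and>
     e * r = r \<and> r * e = r \<and> e * r' = r' \<and> r' * e = r'"

text \<open>The versions with a trailing \<open>z\<close> let the simplifier cancel inside products
  associated to the right.\<close>

lemma local_inverseD:
  assumes "local_inverse e r r'"
  shows "adj e = e" "r * r' = e" "r' * r = e" "e * r = r" "r * e = r" "e * r' = r'" "r' * e = r'"
    and "r * (r' * z) = e * z" "r' * (r * z) = e * z" "e * (r * z) = r * z" "r * (e * z) = r * z"
    and "e * (r' * z) = r' * z" "r' * (e * z) = r' * z"
  using assms by (simp_all add: local_inverse_def mult.assoc[symmetric])

lemma local_inverse_sym: "local_inverse e r r' \<Longrightarrow> local_inverse e r' r"
  by (simp add: local_inverse_def)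

lemma local_inverse_adj: "local_inverse e r r' \<Longrightarrow> local_inverse e (adj r) (adj r')"
  unfolding local_inverse_def by (metis adj_mult)

lemma conjugate_eq_iff:
  assumes "local_inverse e r r'" "local_inverse f n n'"
    and "e * u = u" "u * f = u" "e * v = v" "v * f = v"
  shows "r * u * n' = r * v * n' \<longleftrightarrow> u = v"
proof
  assume "r * u * n' = r * v * n'"
  then have "r' * (r * u * n') * n = r' * (r * v * n') * n" by simp
  then show "u = v"
    using assms(3-) by (simp add: mult.assoc local_inverseD[OF assms(1)] local_inverseD[OF assms(2)])
qed simp

text \<open>For \<open>h = r * u * r'\<close> one has \<open>adj r * r * u = adj r * h * r\<close>,
  and congruence by an invertible \<open>r\<close> preserves and reflects self-adjointness. This
  removes the weight from the symmetry conditions.\<close>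

lemma hermitian_conjugate_iff:
  assumes r: "local_inverse e r r'" and u: "e * u = u" "u * e = u"
  shows "adj (r * u * r') = r * u * r' \<longleftrightarrow> adj (adj r * r * u) = adj r * r * u"
proof -
  define h where "h = r * u * r'"
  have h: "e * h = h" "h * e = h"
    by (simp_all add: h_def mult.assoc local_inverseD[OF r])
  then have h': "e * adj h = adj h" "adj h * e = adj h"
    using local_inverseD(1)[OF r] by (metis adj_mult)+
  have eq: "adj r * r * u = adj r * h * r"
    using u by (simp add: h_def mult.assoc local_inverseD[OF r])
  have "adj (adj r * r * u) = adj r * adj h * r"
    unfolding eq by (simp add: adj_mult mult.assoc)
  then show ?thesis
    unfolding eq h_def[symmetric]
    using conjugate_eq_iff[OF local_inverse_adj[OF r] local_inverse_sym[OF r] h' h] by simp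
qed

text \<open>The substitution \<open>a \<mapsto> r * a * n'\<close> turns the weights \<open>adj r * r\<close> and \<open>adj n * n\<close> into
  units.\<close>

lemma is_mp_inverse_wrt_iff:
  assumes r: "local_inverse e r r'" and n: "local_inverse f n n'"
    and a: "e * a = a" "a * f = a" and x: "f * x = x" "x * e = x"
  shows "is_mp_inverse_wrt (adj r * r) (adj n * n) a x \<longleftrightarrow>
    is_mp_inverse (r * a * n') (n * x * r')"
proof -
  note simps = mult.assoc local_inverseD[OF r] local_inverseD[OF n]
  have ax: "e * (a * z) = a * z" "a * (f * z) = a * z" "f * (x * z) = x * z" "x * (e * z) = x * z" for z
    using a x by (simp_all add: mult.assoc[symmetric])
  have 1: "r * a * n' * (n * x * r') * (r * a * n') = r * a * n' \<longleftrightarrow> a * x * a = a"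
    using conjugate_eq_iff[OF r n, of "a * x * a" a] by (simp add: simps ax a x)
  have 2: "n * x * r' * (r * a * n') * (n * x * r') = n * x * r' \<longleftrightarrow> x * a * x = x"
    using conjugate_eq_iff[OF n r, of "x * a * x" x] by (simp add: simps ax a x)
  have 3: "adj (r * a * n' * (n * x * r')) = r * a * n' * (n * x * r') \<longleftrightarrow>
      adj (adj r * r * a * x) = adj r * r * a * x"
    using hermitian_conjugate_iff[OF r, of "a * x"] by (simp add: simps ax a x)
  have 4: "adj (n * x * r' * (r * a * n')) = n * x * r' * (r * a * n') \<longleftrightarrow>
      adj (adj n * n * x * a) = adj n * n * x * a"
    using hermitian_conjugate_iff[OF n, of "x * a"] by (simp add: simps ax a x)
  show ?thesis
    unfolding is_mp_inverse_wrt_def is_mp_inverse_def 1 2 3 4 ..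
qed

text \<open>The unweighted inverse \<open>z\<close> of \<open>r * a * n'\<close> is pulled back to
  \<open>n' * z * r\<close>. The two unit equations confine \<open>x\<close> to elements of the
  right shape.\<close>

lemma ex1_mp_inverse_wrt:
  assumes r: "local_inverse e r r'" and n: "local_inverse f n n'" and a: "e * a = a" "a * f = a"
  shows "\<exists>!x. f * x = x \<and> x * e = x \<and> is_mp_inverse_wrt (adj r * r) (adj n * n) a x"
proof -
  note simps = mult.assoc local_inverseD[OF r] local_inverseD[OF n]
  let ?a = "r * a * n'"
  obtain z where z: "is_mp_inverse ?a z" using ex_mp_inverse by blast
  \<comment> \<open>These forms of \<open>z\<close> end and begin with \<open>adj ?a\<close>, so
    \<open>z\<close> inherits the units \<open>e\<close> and \<open>f\<close>.\<close>
  have "z = z * adj z * adj ?a" "z = adj ?a * adj z * z"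
    using z unfolding is_mp_inverse_def by (metis adj_mult mult.assoc)+
  moreover have "adj ?a * e = adj ?a" "f * adj ?a = adj ?a"
    by (simp_all add: adj_mult mult.assoc local_inverseD[OF local_inverse_adj[OF r]]
        local_inverseD[OF local_inverse_adj[OF n]])
  ultimately have fz: "f * z = z" and ze: "z * e = z"
    by (metis mult.assoc)+
  have fx: "f * (n' * z * r) = n' * z * r" and xe: "n' * z * r * e = n' * z * r"
    by (simp_all add: simps)
  have "n * (n' * z * r) * r' = z"
    using fz ze by (simp add: simps)
  then have "is_mp_inverse_wrt (adj r * r) (adj n * n) a (n' * z * r)"
    using z is_mp_inverse_wrt_iff[OF r n a fx xe] by simp
  moreover have "x = y"
    if "f * x = x" "x * e = x" "is_mp_inverse_wrt (adj r * r) (adj n * n) a x"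
      and "f * y = y" "y * e = y" "is_mp_inverse_wrt (adj r * r) (adj n * n) a y" for x y
  proof -
    have "n * x * r' = n * y * r'"
      using that is_mp_inverse_wrt_iff[OF r n a] by (blast intro: is_mp_inverse_unique)
    then show ?thesis
      using conjugate_eq_iff[OF n r] that by blast
  qed
  ultimately show ?thesis using fx xe by blast
qed

text \<open>As \<open>n' * adj n'\<close> and \<open>l' * adj l'\<close> invert the weights
  \<open>adj n * n\<close> and \<open>adj l * l\<close>, the elements \<open>a_sharp\<close> and
  \<open>b_sharp\<close> are weighted conjugate transposes. In the conjugated product the inner
  factors \<open>n'\<close> and \<open>n\<close> cancel, so the unweighted law applies.\<close>

theorem weighted_reverse_order_law:
  assumes r: "local_inverse e r r'" and n: "local_inverse f n n'" and l: "local_inverse g l l'"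
    and a: "e * a = a" "a * f = a" and b: "f * b = b" "b * g = b"
    and x: "f * x = x" "x * e = x" and y: "g * y = y" "y * f = y"
    and mp: "is_mp_inverse_wrt (adj r * r) (adj n * n) a x"
      "is_mp_inverse_wrt (adj n * n) (adj l * l) b y"
    and a_sharp: "a_sharp = n' * adj n' * adj a * (adj r * r)"
    and b_sharp: "b_sharp = l' * adj l' * adj b * (adj n * n)"
  shows "is_mp_inverse_wrt (adj r * r) (adj l * l) (a * b) (y * x) \<longleftrightarrow>
    x * a * b * b_sharp * a_sharp = b * b_sharp * a_sharp \<and> adj (adj r * r * a * b * y * x) = adj r * r * a * b * y * x"
proof -
  note simps = mult.assoc local_inverseD[OF r] local_inverseD[OF n] local_inverseD[OF l]
    local_inverseD[OF local_inverse_adj[OF r]] local_inverseD[OF local_inverse_adj[OF n]]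
    local_inverseD[OF local_inverse_adj[OF l]]
  have ax: "e * (a * z) = a * z" "a * (f * z) = a * z" "f * (b * z) = b * z" "b * (g * z) = b * z"
    "f * (x * z) = x * z" "x * (e * z) = x * z" "g * (y * z) = y * z" "y * (f * z) = y * z" for z
    using a b x y by (simp_all add: mult.assoc[symmetric])
  have adj: "adj a * e = adj a" "f * adj a = adj a"
    using a local_inverseD(1)[OF r] local_inverseD(1)[OF n] by (metis adj_mult)+
  then have adj': "adj a * (e * z) = adj a * z" "f * (adj a * z) = adj a * z" for z
    by (simp_all add: mult.assoc[symmetric])
  define a0 b0 x0 y0 where "a0 = r * a * n'" and "b0 = n * b * l'" and "x0 = n * x * r'" and "y0 = l * y * n'"
  \<comment> \<open>The common core of both versions of (i): after the middle weights cancel, each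
    compares \<open>x * a * w\<close> with \<open>w\<close>, up to invertible outer factors.\<close>
  define w where "w = b * l' * adj l' * adj b * adj a"
  have "is_mp_inverse a0 x0" "is_mp_inverse b0 y0"
    using mp is_mp_inverse_wrt_iff[OF r n a x] is_mp_inverse_wrt_iff[OF n l b y]
    unfolding a0_def b0_def x0_def y0_def by simp_all
  then have law: "is_mp_inverse (a0 * b0) (y0 * x0) \<longleftrightarrow>
      x0 * a0 * b0 * adj b0 * adj a0 = b0 * adj b0 * adj a0 \<and> adj (a0 * b0 * y0 * x0) = a0 * b0 * y0 * x0"
    by (rule reverse_order_law)
  have "is_mp_inverse_wrt (adj r * r) (adj l * l) (a * b) (y * x) \<longleftrightarrow>
      is_mp_inverse (r * (a * b) * l') (l * (y * x) * r')"
    by (rule is_mp_inverse_wrt_iff[OF r l]) (use a b x y ax in \<open>simp_all add: mult.assoc\<close>)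
  moreover have "r * (a * b) * l' = a0 * b0" "l * (y * x) * r' = y0 * x0"
    by (simp_all add: a0_def b0_def x0_def y0_def simps ax)
  moreover have "x0 * a0 * b0 * adj b0 * adj a0 = b0 * adj b0 * adj a0 \<longleftrightarrow> x * a * b * b_sharp * a_sharp = b * b_sharp * a_sharp"
  proof -
    have 1: "b0 * adj b0 * adj a0 = n * w * adj r" "x0 * a0 * b0 * adj b0 * adj a0 = n * (x * a * w) * adj r"
      by (simp_all add: a0_def b0_def x0_def w_def adj_mult simps ax adj')
    have 2: "b * b_sharp * a_sharp = f * w * (adj r * r)" "x * a * b * b_sharp * a_sharp = f * (x * a * w) * (adj r * r)"
      by (simp_all add: w_def a_sharp b_sharp adj_mult simps ax adj')
    \<comment> \<open>The weighted condition has no conjugating factor on the left, so the unit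
      \<open>f\<close> takes its place.\<close>
    have ff: "local_inverse f f f"
      using local_inverseD[OF n] unfolding local_inverse_def by (metis mult.assoc)
    have rr: "local_inverse e (r' * adj r') (adj r * r)"
      unfolding local_inverse_def by (simp add: simps)
    have w: "f * (x * a * w) = x * a * w" "x * a * w * e = x * a * w" "f * w = w" "w * e = w"
      by (simp_all add: w_def mult.assoc ax adj)
    show ?thesis
      unfolding 1 2 conjugate_eq_iff[OF n local_inverse_adj[OF local_inverse_sym[OF r]] w]
        conjugate_eq_iff[OF ff rr w] ..
  qed
  moreover have "adj (a0 * b0 * y0 * x0) = a0 * b0 * y0 * x0 \<longleftrightarrow>
      adj (adj r * r * a * b * y * x) = adj r * r * a * b * y * x"
    using hermitian_conjugate_iff[OF r, of "a * b * y * x"] a x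
    by (simp add: a0_def b0_def x0_def y0_def simps ax)
  ultimately show ?thesis
    using law by simp
qed

end

section \<open>Finite complex matrices\<close>

text \<open>A finite matrix is encoded as a function on pairs of indices with finite support, so that
  matrices of all shapes are elements of one (non-unital) ring.\<close>

typedef 'a finmat = "{f :: 'a \<Rightarrow> 'a \<Rightarrow> complex. \<exists>S. finite S \<and> (\<forall>i j. f i j \<noteq> 0 \<longrightarrow> i \<in> S \<and> j \<in> S)}"
  by (rule exI[of _ "\<lambda>_ _. 0"]) auto

setup_lifting type_definition_finmat

lift_definition coeff :: "'a finmat \<Rightarrow> 'a \<Rightarrow> 'a \<Rightarrow> complex" is "\<lambda>f. f" .

lemma finmat_eqI: "(\<And>i j. coeff A i j = coeff B i j) \<Longrightarrow> A = B"
  by transfer auto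

lemma finite_support_coeff:
  obtains S where "finite S" "\<And>i j. coeff A i j \<noteq> 0 \<Longrightarrow> i \<in> S \<and> j \<in> S"
  using that by transfer blast

text \<open>Infinite index sets give the zero matrix, which keeps the support finite for all
  arguments.\<close>

lift_definition finmat :: "'a set \<Rightarrow> 'a set \<Rightarrow> ('a \<Rightarrow> 'a \<Rightarrow> complex) \<Rightarrow> 'a finmat" is
  "\<lambda>I J f i j. if finite I \<and> finite J \<and> i \<in> I \<and> j \<in> J then f i j else 0"
  by (rule_tac x = "if finite set1 \<and> finite set2 then set1 \<union> set2 else {}" in exI) auto

lemma coeff_finmat:
  assumes "finite I" "finite J"
  shows "coeff (finmat I J f) i j = (if i \<in> I \<and> j \<in> J then f i j else 0)"
  using assms by transfer auto

lemma coeff_finmat_infinite: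
  assumes "\<not> (finite I \<and> finite J)"
  shows "coeff (finmat I J f) i j = 0"
  using assms by transfer auto

instantiation finmat :: (type) "{zero, plus, minus, uminus, times}"
begin

lift_definition zero_finmat :: "'a finmat" is "\<lambda>_ _. 0"
  by auto

lift_definition plus_finmat :: "'a finmat \<Rightarrow> 'a finmat \<Rightarrow> 'a finmat" is "\<lambda>f g i j. f i j + g i j"
proof -
  fix f g :: "'a \<Rightarrow> 'a \<Rightarrow> complex"
  assume "\<exists>S. finite S \<and> (\<forall>i j. f i j \<noteq> 0 \<longrightarrow> i \<in> S \<and> j \<in> S)"
    and "\<exists>S. finite S \<and> (\<forall>i j. g i j \<noteq> 0 \<longrightarrow> i \<in> S \<and> j \<in> S)"
  then obtain S T where "finite S" "\<forall>i j. f i j \<noteq> 0 \<longrightarrow> i \<in> S \<and> j \<in> S"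
    and "finite T" "\<forall>i j. g i j \<noteq> 0 \<longrightarrow> i \<in> T \<and> j \<in> T"
    by blast
  then show "\<exists>S. finite S \<and> (\<forall>i j. f i j + g i j \<noteq> 0 \<longrightarrow> i \<in> S \<and> j \<in> S)"
    by (intro exI[of _ "S \<union> T"]) (metis UnCI add.right_neutral finite_UnI)
qed

lift_definition uminus_finmat :: "'a finmat \<Rightarrow> 'a finmat" is "\<lambda>f i j. - f i j"
  by auto

lift_definition times_finmat :: "'a finmat \<Rightarrow> 'a finmat \<Rightarrow> 'a finmat" is
  "\<lambda>f g i k. \<Sum>j | f i j \<noteq> 0. f i j * g j k"
proof -
  fix f g :: "'a \<Rightarrow> 'a \<Rightarrow> complex"
  assume "\<exists>S. finite S \<and> (\<forall>i j. f i j \<noteq> 0 \<longrightarrow> i \<in> S \<and> j \<in> S)"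
    and "\<exists>S. finite S \<and> (\<forall>i j. g i j \<noteq> 0 \<longrightarrow> i \<in> S \<and> j \<in> S)"
  then obtain S T where S: "finite S" "\<forall>i j. f i j \<noteq> 0 \<longrightarrow> i \<in> S \<and> j \<in> S"
    and T: "finite T" "\<forall>i j. g i j \<noteq> 0 \<longrightarrow> i \<in> T \<and> j \<in> T"
    by blast
  have "i \<in> S \<and> k \<in> T" if "(\<Sum>j | f i j \<noteq> 0. f i j * g j k) \<noteq> 0" for i k
    using sum.not_neutral_contains_not_neutral[OF that] S(2) T(2) by (metis mult_eq_0_iff)
  then show "\<exists>S. finite S \<and>
      (\<forall>i k. (\<Sum>j | f i j \<noteq> 0. f i j * g j k) \<noteq> 0 \<longrightarrow> i \<in> S \<and> k \<in> S)"
    using S(1) T(1) by (intro exI[of _ "S \<union> T"]) auto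
qed

definition "A - B = A + - B" for A B :: "'a finmat"

instance ..

end

lemma coeff_zero [simp]: "coeff 0 i j = 0"
  and coeff_plus [simp]: "coeff (A + B) i j = coeff A i j + coeff B i j"
  and coeff_uminus [simp]: "coeff (- A) i j = - coeff A i j"
  by (transfer, simp)+

lemma coeff_minus [simp]: "coeff (A - B) i j = coeff A i j - coeff B i j"
  by (simp add: minus_finmat_def)

text \<open>The defining sum runs over the nonzero entries of one row; padding with zeros lets
  several products share one finite index set.\<close>

lemma coeff_times_left:
  assumes "finite S" "\<And>j. coeff A i j \<noteq> 0 \<Longrightarrow> j \<in> S"
  shows "coeff (A * B) i k = (\<Sum>j\<in>S. coeff A i j * coeff B j k)"
proof -
  have "coeff (A * B) i k = (\<Sum>j | coeff A i j \<noteq> 0. coeff A i j * coeff B j k)"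
    by transfer simp
  also have "\<dots> = (\<Sum>j\<in>S. coeff A i j * coeff B j k)"
    using assms by (intro sum.mono_neutral_left) auto
  finally show ?thesis .
qed

instance finmat :: (type) ring
proof
  fix A B C :: "'a finmat"
  obtain S where S: "finite S" "\<And>i j. coeff A i j \<noteq> 0 \<Longrightarrow> i \<in> S \<and> j \<in> S"
    using finite_support_coeff[of A] by blast
  obtain T where T: "finite T" "\<And>i j. coeff B i j \<noteq> 0 \<Longrightarrow> i \<in> T \<and> j \<in> T"
    using finite_support_coeff[of B] by blast
  have A: "coeff (A * X) i k = (\<Sum>j\<in>S \<union> T. coeff A i j * coeff X j k)"
    and B: "coeff (B * X) i k = (\<Sum>j\<in>S \<union> T. coeff B i j * coeff X j k)"
for X i k
    using S T by (intro coeff_times_left; force)+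
  have AB: "coeff ((A + B) * X) i k = (\<Sum>j\<in>S \<union> T. coeff (A + B) i j * coeff X j k)" for X i k
  proof (rule coeff_times_left)
    show "j \<in> S \<union> T" if "coeff (A + B) i j \<noteq> 0" for j
      using that S(2)[of i j] T(2)[of i j] by (cases "coeff A i j = 0") auto
  qed (use S T in simp)
  have "coeff (A * B) i k \<noteq> 0 \<Longrightarrow> k \<in> S \<union> T" for i k
    unfolding A using T(2) by (metis (no_types, lifting) UnCI mult_zero_right sum.neutral)
  then have "coeff (A * B * C) i k = (\<Sum>j\<in>S \<union> T. coeff (A * B) i j * coeff C j k)" for i k
    using S T by (intro coeff_times_left) auto
  moreover have "(\<Sum>j\<in>S \<union> T. (\<Sum>l\<in>S \<union> T. coeff A i l * coeff B l j) * coeff C j k)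
      = (\<Sum>l\<in>S \<union> T. coeff A i l * (\<Sum>j\<in>S \<union> T. coeff B l j * coeff C j k))" for i k
    unfolding sum_distrib_left sum_distrib_right mult.assoc by (rule sum.swap)
  ultimately show "A * B * C = A * (B * C)"
    by (intro finmat_eqI) (simp add: A B)
  show "(A + B) * C = A * C + B * C"
    by (rule finmat_eqI) (simp add: A B AB distrib_right sum.distrib)
  show "A * (B + C) = A * B + A * C"
    by (rule finmat_eqI) (simp add: A distrib_left sum.distrib)
qed (auto intro!: finmat_eqI)

text \<open>McCoy's lemma: the witness is \<open>w + (1 - w * a) * g * (1 - a * w)\<close>, multiplied out since there is no unit.\<close>

lemma inner_inverse_residual:
  fixes a :: "'a :: ring"
  assumes "(a - a * w * a) * g * (a - a * w * a) = a - a * w * a"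
  shows "a * (w + g - w * a * g - g * a * w + w * a * g * a * w) * a = a"
  using assms by (simp add: algebra_simps)

text \<open>With \<open>w\<close> the inverse of a pivot entry in transposed position, \<open>A - A * w * A\<close> is the
  result of one step of Gaussian elimination and has fewer nonzero rows than \<open>A\<close>.\<close>

lemma ex_inner_inverse_finmat: "\<exists>G. A * G * A = (A :: 'a finmat)"
proof (induction "card {i. \<exists>j. coeff A i j \<noteq> 0}" arbitrary: A rule: less_induct)
  case less
  show ?case
  proof (cases "A = 0")
    case False
    then obtain p q where pq: "coeff A p q \<noteq> 0"
      by (metis finmat_eqI coeff_zero)
    define W where "W = finmat {q} {p} (\<lambda>_ _. inverse (coeff A p q))"
    define R where "R = A - A * W * A"
    obtain S where S: "finite S" "\<And>i j. coeff A i j \<noteq> 0 \<Longrightarrow> i \<in> S \<and> j \<in> S"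
      using finite_support_coeff[of A] by blast
    have WA: "coeff (W * A) i k = (if i = q then inverse (coeff A p q) * coeff A p k else 0)" for i k
      by (subst coeff_times_left[of "{p}"]) (auto simp: W_def coeff_finmat split: if_splits)
    have "coeff (A * (W * A)) i k = (\<Sum>j\<in>S. coeff A i j * coeff (W * A) j k)" for i k
      using S by (intro coeff_times_left) auto
    also have "\<dots> i k = coeff A i q * inverse (coeff A p q) * coeff A p k" for i k
      using S pq by (simp add: WA if_distrib cong: if_cong)
    finally have R: "coeff R i k = coeff A i k - coeff A i q * inverse (coeff A p q) * coeff A p k" for i k
      by (simp add: R_def mult.assoc)
    \<comment> \<open>Elimination clears the pivot row \<open>p\<close> and creates no new nonzero
      row.\<close>
    have "{i. \<exists>j. coeff R i j \<noteq> 0} \<subseteq> {i. \<exists>j. coeff A i j \<noteq> 0} - {p}"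
    proof -
      have "coeff R p j = 0" and "(\<forall>k. coeff A i k = 0) \<Longrightarrow> coeff R i j = 0" for i j
        using pq by (simp_all add: R)
      then show ?thesis by blast
    qed
    also have "\<dots> \<subset> {i. \<exists>j. coeff A i j \<noteq> 0}"
      using pq by auto
    finally have "card {i. \<exists>j. coeff R i j \<noteq> 0} < card {i. \<exists>j. coeff A i j \<noteq> 0}"
      by (intro psubset_card_mono finite_subset[OF _ S(1)]) (use S(2) in auto)
    then obtain G where "R * G * R = R"
      using less by blast
    then show ?thesis
      using inner_inverse_residual[of A W G] unfolding R_def by blast
  qed auto
qed

instantiation finmat :: (type) regular_star_ring
begin

lift_definition adj_finmat :: "'a finmat \<Rightarrow> 'a finmat" is "\<lambda>f i j. cnj (f j i)"
  by (simp, blast)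

lemma coeff_adj [simp]: "coeff (adj A) i j = cnj (coeff A j i)"
  by transfer simp

instance
proof
  fix A B :: "'a finmat"
  show "adj (A - B) = adj A - adj B"
    by (rule finmat_eqI) simp
  show "adj (adj A) = A"
    by (rule finmat_eqI) simp
  obtain S where S: "finite S" "\<And>i j. coeff A i j \<noteq> 0 \<Longrightarrow> i \<in> S \<and> j \<in> S"
    using finite_support_coeff[of A] by blast
  have A: "coeff (A * X) i k = (\<Sum>j\<in>S. coeff A i j * coeff X j k)"
    and A': "coeff (adj A * X) i k = (\<Sum>j\<in>S. coeff (adj A) i j * coeff X j k)" for X i k
    using S by (intro coeff_times_left; force)+
  obtain T where T: "finite T" "\<And>i j. coeff B i j \<noteq> 0 \<Longrightarrow> i \<in> T \<and> j \<in> T"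
    using finite_support_coeff[of B] by blast
  have AB: "coeff (A * X) i k = (\<Sum>j\<in>S \<union> T. coeff A i j * coeff X j k)"
    and BA: "coeff (adj B * X) i k = (\<Sum>j\<in>S \<union> T. coeff (adj B) i j * coeff X j k)" for X i k
    using S T by (intro coeff_times_left; force)+
  show "adj (A * B) = adj B * adj A"
    by (rule finmat_eqI) (simp add: AB BA mult.commute)
  show "A = 0" if "adj A * A = 0"
  proof (rule finmat_eqI)
    fix i j
    \<comment> \<open>The diagonal entries of \<open>adj A * A\<close> are the squared norms of the
      columns of \<open>A\<close>.\<close>
    have "(\<Sum>i\<in>S. (cmod (coeff A i j))\<^sup>2) = Re (coeff (adj A * A) j j)"
      by (simp add: A' complex_norm_square[symmetric] mult.commute del: of_real_power)
    then have "(\<Sum>i\<in>S. (cmod (coeff A i j))\<^sup>2) = 0"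
      using that by simp
    then have "i \<in> S \<Longrightarrow> coeff A i j = 0"
      using S(1) by (simp add: sum_nonneg_eq_0_iff)
    then show "coeff A i j = coeff 0 i j"
      using S(2) by auto
  qed
  show "\<exists>G. A * G * A = A"
    by (rule ex_inner_inverse_finmat)
qed

end

lemma adj_finmat: "adj (finmat I J f) = finmat J I (\<lambda>j i. cnj (f i j))"
  by (rule finmat_eqI, cases "finite I \<and> finite J") (auto simp: coeff_finmat coeff_finmat_infinite)

abbreviation diag :: "'a set \<Rightarrow> ('a \<Rightarrow> complex) \<Rightarrow> 'a finmat" where
  "diag I d \<equiv> finmat I I (\<lambda>i j. if i = j then d i else 0)"

lemma finmat_mult:
  assumes "finite I" "finite J" "finite K"
  shows "finmat I J f * finmat J K g = finmat I K (\<lambda>i k. \<Sum>j\<in>J. f i j * g j k)"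
proof (rule finmat_eqI)
  fix i k
  have "coeff (finmat I J f * finmat J K g) i k =
      (\<Sum>j\<in>J. coeff (finmat I J f) i j * coeff (finmat J K g) j k)"
    using assms by (intro coeff_times_left) (auto simp: coeff_finmat split: if_splits)
  then show "coeff (finmat I J f * finmat J K g) i k =
      coeff (finmat I K (\<lambda>i k. \<Sum>j\<in>J. f i j * g j k)) i k"
    using assms by (auto simp: coeff_finmat)
qed

lemma finmat_cong:
  assumes "\<And>i j. i \<in> I \<Longrightarrow> j \<in> J \<Longrightarrow> f i j = g i j"
  shows "finmat I J f = finmat I J g"
  using assms by transfer (auto simp: fun_eq_iff)

lemma diag_mult_finmat:
  assumes "finite I" "finite J"
  shows "diag I d * finmat I J f = finmat I J (\<lambda>i j. d i * f i j)"
  using assms by (subst finmat_mult) (auto intro!: finmat_cong simp: if_distrib[of "\<lambda>x. x * _"] cong: if_cong)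

lemma finmat_mult_diag:
  assumes "finite I" "finite J"
  shows "finmat I J f * diag J d = finmat I J (\<lambda>i j. f i j * d j)"
  using assms by (subst finmat_mult) (auto intro!: finmat_cong simp: if_distrib cong: if_cong)

section \<open>Tensors as matrices\<close>

text \<open>Multi-indices label rows and columns directly, so tensors of every shape land in the one
  ring \<open>nat list finmat\<close>.\<close>

definition tensor_mat :: "nat list \<Rightarrow> nat list \<Rightarrow> ctensor \<Rightarrow> nat list finmat" where
  "tensor_mat Is Js A = finmat (multi_indices Is) (multi_indices Js) (\<lambda>i j. A $$ (i @ j))"

abbreviation unit_mat :: "nat list \<Rightarrow> nat list finmat" where
  "unit_mat Is \<equiv> diag (multi_indices Is) (\<lambda>_. 1)"

lemma finite_multi_indices [simp]: "finite (multi_indices ds)"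
proof (rule finite_subset)
  \<comment> \<open>For empty \<open>ds\<close> the value of \<open>Max\<close> is irrelevant, as
    only the empty list occurs.\<close>
  show "multi_indices ds \<subseteq> {i. set i \<subseteq> {..<Max (set ds)} \<and> length i = length ds}"
    by (auto simp: multi_indices_def list_all2_conv_all_nth in_set_conv_nth)
      (metis List.finite_set Max_ge less_le_trans nth_mem)
qed (simp add: finite_lists_length_eq)

lemma tensor_mat_einstein:
  assumes "A \<in> tensors (Is @ Js)" "B \<in> tensors (Js @ Ks)"
  shows "tensor_mat Is Ks (A \<star>\<^bsub>length Js\<^esub> B) = tensor_mat Is Js A * tensor_mat Js Ks B"
  unfolding tensor_mat_def by (subst finmat_mult) (auto intro!: finmat_cong simp: einstein_entry[OF assms])

lemma tensor_mat_conj_transpose: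
  assumes "A \<in> tensors (Is @ Js)"
  shows "tensor_mat Js Is (conj_transpose (length Is) A) = adj (tensor_mat Is Js A)"
  unfolding tensor_mat_def adj_finmat by (rule finmat_cong) (simp add: conj_transpose_entry[OF assms])

lemma multi_indices_append_cases:
  assumes "x \<in> multi_indices (Is @ Js)"
  obtains i j where "x = i @ j" "i \<in> multi_indices Is" "j \<in> multi_indices Js"
  using assms by (auto simp: multi_indices_def list_all2_append2)

lemma tensor_mat_eq_iff:
  assumes "A \<in> tensors (Is @ Js)" "B \<in> tensors (Is @ Js)"
  shows "tensor_mat Is Js A = tensor_mat Is Js B \<longleftrightarrow> A = B"
proof
  assume eq: "tensor_mat Is Js A = tensor_mat Is Js B"
  have "A $$ (i @ j) = B $$ (i @ j)" if "i \<in> multi_indices Is" "j \<in> multi_indices Js" for i j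
    using arg_cong[OF eq, of "\<lambda>X. coeff X i j"] that by (simp add: tensor_mat_def coeff_finmat)
  then show "A = B"
    using assms by (intro ctensor_eqI) (auto simp: tensors_def elim!: multi_indices_append_cases)
qed simp

lemma unit_mat_mult_emb [simp]: "unit_mat Is * tensor_mat Is Js A = tensor_mat Is Js A"
  by (simp add: tensor_mat_def diag_mult_finmat)

lemma tensor_mat_mult_unit_mat [simp]: "tensor_mat Is Js A * unit_mat Js = tensor_mat Is Js A"
  by (simp add: tensor_mat_def finmat_mult_diag)

text \<open>The unit equations force \<open>X\<close> to vanish outside the index rectangle. Ring
  elements constructed later thus come back as tensors.\<close>

lemma tensor_mat_surj:
  assumes "unit_mat Is * X = X" "X * unit_mat Js = X"
  obtains A where "A \<in> tensors (Is @ Js)" "tensor_mat Is Js A = X"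
proof
  let ?A = "mk_tensor (Is @ Js) (\<lambda>x. coeff X (take (length Is) x) (drop (length Is) x))"
  show "?A \<in> tensors (Is @ Js)"
    by (simp add: tensors_def)
  obtain S where S: "finite S" "\<And>i j. coeff X i j \<noteq> 0 \<Longrightarrow> i \<in> S \<and> j \<in> S"
    using finite_support_coeff[of X] by blast
  have "coeff X i j = 0" if "i \<notin> multi_indices Is" for i j
  proof -
    have "coeff (unit_mat Is * X) i j = 0"
      by (subst coeff_times_left[of "{}"]) (use that in \<open>auto simp: coeff_finmat\<close>)
    then show ?thesis using assms by simp
  qed
  moreover have "coeff X i j = 0" if "j \<notin> multi_indices Js" for i j
  proof -
    have "coeff (X * unit_mat Js) i j = (\<Sum>k\<in>S. coeff X i k * coeff (unit_mat Js) k j)"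
      using S by (intro coeff_times_left) auto
    also have "\<dots> = 0"
      using that by (auto simp: coeff_finmat)
    finally show ?thesis using assms by simp
  qed
  ultimately show "tensor_mat Is Js ?A = X"
    by (intro finmat_eqI)
      (auto simp: tensor_mat_def coeff_finmat multi_indices_append_iff length_multi_indices)
qed

section \<open>Identity tensors and positive definite weights\<close>

lemma identity_tensor_in_tensors [simp]: "identity_tensor Is \<in> tensors (Is @ Is)"
  by (simp add: identity_tensor_def tensors_def)

lemma tensor_mat_identity_tensor [simp]: "tensor_mat Is Is (identity_tensor Is) = unit_mat Is"
  unfolding tensor_mat_def
proof (rule finmat_cong)
  fix i j assume ij: "i \<in> multi_indices Is" "j \<in> multi_indices Is"
  have "(\<Prod>k<length Is. if (i @ j) ! k = (i @ j) ! (length Is + k) then 1 else 0 :: complex) =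
      (if i = j then 1 else 0)"
    using ij by (auto simp: length_multi_indices list_eq_iff_nth_eq nth_append)
  then show "identity_tensor Is $$ (i @ j) = (if i = j then 1 else 0)"
    using ij by (simp add: identity_tensor_def multi_indices_append_iff length_multi_indices)
qed

text \<open>With \<open>s\<close> the entrywise square root of the diagonal factor and
  \<open>s'\<close> its inverse, take \<open>r = s * adj u\<close> and
  \<open>r' = u * s'\<close>.\<close>

lemma hermitian_pos_def_factorization:
  assumes "hermitian_pos_def Is P"
  obtains r r' where "local_inverse (unit_mat Is) r r'" "tensor_mat Is Is P = adj r * r"
proof -
  obtain U D where U: "unitary_tensor Is U" and D: "diagonal_tensor Is D"
    and pos: "\<And>i. i \<in> multi_indices Is \<Longrightarrow> D $$ (i @ i) \<in> \<real> \<and> 0 < Re (D $$ (i @ i))"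
    and P: "P = U \<star>\<^bsub>length Is\<^esub> D \<star>\<^bsub>length Is\<^esub> conj_transpose (length Is) U"
    using assms unfolding hermitian_pos_def_def by blast
  have UT: "U \<in> tensors (Is @ Is)" and DT: "D \<in> tensors (Is @ Is)"
    and U1: "U \<star>\<^bsub>length Is\<^esub> conj_transpose (length Is) U = identity_tensor Is"
    and U2: "conj_transpose (length Is) U \<star>\<^bsub>length Is\<^esub> U = identity_tensor Is"
    using U D by (simp_all add: unitary_tensor_def diagonal_tensor_def)
  define e u s s' where "e = unit_mat Is" and "u = tensor_mat Is Is U"
    and "s = diag (multi_indices Is) (\<lambda>i. of_real (sqrt (Re (D $$ (i @ i)))))"
    and "s' = diag (multi_indices Is) (\<lambda>i. of_real (1 / sqrt (Re (D $$ (i @ i)))))"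
  have uu: "u * adj u = e" "adj u * u = e"
    using arg_cong[OF U1, of "tensor_mat Is Is"] arg_cong[OF U2, of "tensor_mat Is Is"] UT
    by (simp_all add: tensor_mat_einstein tensor_mat_conj_transpose conj_transpose_in_tensors u_def e_def)
  have eu: "e * u = u" "u * e = u"
    by (simp_all add: e_def u_def)
  have ee: "adj e = e"
    by (auto simp: e_def adj_finmat intro!: finmat_cong)
  have eu': "e * adj u = adj u" "adj u * e = adj u"
    using eu ee by (metis adj_mult)+
  have es: "e * s = s" "s * e = s" "e * s' = s'" "s' * e = s'" and as: "adj s = s"
    by (auto simp: e_def s_def s'_def diag_mult_finmat finmat_mult_diag adj_finmat intro!: finmat_cong)
  have nz: "Re (D $$ (i @ i)) \<noteq> 0" if "i \<in> multi_indices Is" for i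
    using pos[OF that] by simp
  have ss: "s * s' = e" "s' * s = e"
    by (auto simp: e_def s_def s'_def diag_mult_finmat nz simp flip: of_real_mult intro!: finmat_cong)
  \<comment> \<open>The diagonal entries are real and positive, so squaring the root of the real
    part recovers them.\<close>
  have "s * s = tensor_mat Is Is D"
    using pos D unfolding s_def tensor_mat_def
    by (auto simp: diag_mult_finmat diagonal_tensor_def less_imp_le simp flip: of_real_mult
        intro!: finmat_cong)
  then have PP: "tensor_mat Is Is P = adj (s * adj u) * (s * adj u)"
    using UT DT by (simp add: P tensor_mat_einstein tensor_mat_conj_transpose conj_transpose_in_tensors
        einstein_in_tensors adj_mult as u_def mult.assoc flip: mult.assoc[of s s])
  have "local_inverse e (s * adj u) (u * s')"
    unfolding local_inverse_def
    by (metis ee uu eu eu' es ss mult.assoc)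
  with PP show thesis
    using that e_def by blast
qed

text \<open>In the ring, the two inverse equations hold exactly for \<open>r' * adj r'\<close>.
  Surjectivity and injectivity of \<open>tensor_mat\<close> then make the definite description well
  defined.\<close>

lemma tensor_inverse:
  assumes "P \<in> tensors (Is @ Is)" "local_inverse (unit_mat Is) r r'" "tensor_mat Is Is P = adj r * r"
  shows "tensor_inverse Is P \<in> tensors (Is @ Is)"
    and "tensor_mat Is Is (tensor_inverse Is P) = r' * adj r'"
proof -
  note r = local_inverseD[OF assms(2)] local_inverseD[OF local_inverse_adj[OF assms(2)]]
  let ?inv = "\<lambda>Q. Q \<in> tensors (Is @ Is) \<and> P \<star>\<^bsub>length Is\<^esub> Q = identity_tensor Is \<and>
    Q \<star>\<^bsub>length Is\<^esub> P = identity_tensor Is"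
  have inv: "?inv Q \<longleftrightarrow> Q \<in> tensors (Is @ Is) \<and> tensor_mat Is Is Q = r' * adj r'" for Q
  proof (cases "Q \<in> tensors (Is @ Is)")
    case True
    let ?q = "tensor_mat Is Is Q"
    have "?inv Q \<longleftrightarrow> adj r * r * ?q = unit_mat Is \<and> ?q * (adj r * r) = unit_mat Is"
      using True assms(1)
      by (simp add: tensor_mat_eq_iff[of _ Is Is, symmetric] einstein_in_tensors tensor_mat_einstein assms(3))
    also have "\<dots> \<longleftrightarrow> ?q = r' * adj r'"
    proof
      assume *: "adj r * r * ?q = unit_mat Is \<and> ?q * (adj r * r) = unit_mat Is"
      have "?q = r' * adj r' * (adj r * r * ?q)"
        by (simp add: mult.assoc r)
      also have "\<dots> = r' * adj r'"
        using * by (simp add: mult.assoc r)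
      finally show "?q = r' * adj r'" .
    qed (simp add: mult.assoc r)
    finally show ?thesis using True by simp
  qed simp
  obtain Q where Q: "Q \<in> tensors (Is @ Is)" "tensor_mat Is Is Q = r' * adj r'"
    using tensor_mat_surj[of Is "r' * adj r'" Is] by (auto simp: mult.assoc r)
  have "\<exists>!Q. ?inv Q"
    unfolding inv using Q tensor_mat_eq_iff by metis
  from theI'[OF this, unfolded inv] show "tensor_inverse Is P \<in> tensors (Is @ Is)"
    and "tensor_mat Is Is (tensor_inverse Is P) = r' * adj r'"
    by (simp_all only: tensor_inverse_def inv)
qed

section \<open>Weighted inverses of tensors and the final transfer\<close>

lemma is_weighted_mp_inverse_iff:
  assumes "A \<in> tensors (Is @ Js)" "S \<in> tensors (Is @ Is)" "T \<in> tensors (Js @ Js)"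
    and "X \<in> tensors (Js @ Is)"
  shows "is_weighted_mp_inverse Is Js S T A X \<longleftrightarrow>
    is_mp_inverse_wrt (tensor_mat Is Is S) (tensor_mat Js Js T) (tensor_mat Is Js A) (tensor_mat Js Is X)"
  using assms unfolding is_weighted_mp_inverse_def is_mp_inverse_wrt_def Let_def
  by (simp add: tensor_mat_eq_iff[of _ Is Js, symmetric] tensor_mat_eq_iff[of _ Js Is, symmetric]
      tensor_mat_eq_iff[of _ Is Is, symmetric] tensor_mat_eq_iff[of _ Js Js, symmetric]
      einstein_in_tensors conj_transpose_in_tensors tensor_mat_einstein tensor_mat_conj_transpose)

text \<open>Existence and uniqueness pass from the ring to tensors because \<open>tensor_mat\<close>
  maps \<open>tensors (Js @ Is)\<close> bijectively onto the matrices fixed by the two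
  units.\<close>

lemma weighted_mp_inverse:
  assumes A: "A \<in> tensors (Is @ Js)" and S: "S \<in> tensors (Is @ Is)" and T: "T \<in> tensors (Js @ Js)"
    and r: "local_inverse (unit_mat Is) r r'" "tensor_mat Is Is S = adj r * r"
    and n: "local_inverse (unit_mat Js) n n'" "tensor_mat Js Js T = adj n * n"
  shows "is_weighted_mp_inverse Is Js S T A Z \<longleftrightarrow> Z = weighted_mp_inverse Is Js S T A"
    and "weighted_mp_inverse Is Js S T A \<in> tensors (Js @ Is)"
    and "is_mp_inverse_wrt (adj r * r) (adj n * n) (tensor_mat Is Js A)
      (tensor_mat Js Is (weighted_mp_inverse Is Js S T A))"
proof -
  have tensor: "X \<in> tensors (Js @ Is)" if "is_weighted_mp_inverse Is Js S T A X" for X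
    using that by (simp add: is_weighted_mp_inverse_def Let_def)
  have iff: "is_weighted_mp_inverse Is Js S T A X \<longleftrightarrow>
      is_mp_inverse_wrt (adj r * r) (adj n * n) (tensor_mat Is Js A) (tensor_mat Js Is X)"
    if "X \<in> tensors (Js @ Is)" for X
    using is_weighted_mp_inverse_iff[OF A S T that] r n by simp
  note ex1 = ex1_mp_inverse_wrt[OF r(1) n(1) unit_mat_mult_emb tensor_mat_mult_unit_mat, of A]
  obtain x where x: "unit_mat Js * x = x" "x * unit_mat Is = x"
    "is_mp_inverse_wrt (adj r * r) (adj n * n) (tensor_mat Is Js A) x"
    using ex1 by blast
  obtain X where X: "X \<in> tensors (Js @ Is)" "tensor_mat Js Is X = x"
    using tensor_mat_surj[OF x(1,2)] by blast
  have ex1X: "\<exists>!X. is_weighted_mp_inverse Is Js S T A X"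
  proof
    show "is_weighted_mp_inverse Is Js S T A X"
      using iff X x by simp
    fix Y assume Y: "is_weighted_mp_inverse Is Js S T A Y"
    then have "tensor_mat Js Is Y = x"
      using ex1 x iff[OF tensor[OF Y]] by (metis unit_mat_mult_emb tensor_mat_mult_unit_mat)
    then show "Y = X"
      using X tensor[OF Y] tensor_mat_eq_iff by metis
  qed
  have the: "is_weighted_mp_inverse Is Js S T A (weighted_mp_inverse Is Js S T A)"
    unfolding weighted_mp_inverse_def by (rule theI'[OF ex1X])
  show "is_weighted_mp_inverse Is Js S T A Z \<longleftrightarrow> Z = weighted_mp_inverse Is Js S T A"
    using ex1X the by blast
  show "weighted_mp_inverse Is Js S T A \<in> tensors (Js @ Is)"
    using the by (rule tensor)
  then show "is_mp_inverse_wrt (adj r * r) (adj n * n) (tensor_mat Is Js A)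
      (tensor_mat Js Is (weighted_mp_inverse Is Js S T A))"
    using iff the by blast
qed

theorem theorem4p12:
  fixes Is Js Ks :: "nat list" and M N L :: nat
    and \<A> \<B> \<M> \<N> \<L> :: ctensor
  assumes "length Is = M" and "length Js = N" and "length Ks = L"
    and "\<A> \<in> tensors (Is @ Js)" and "\<B> \<in> tensors (Js @ Ks)"
    and "\<M> \<in> tensors (Is @ Is)" and "hermitian_pos_def Is \<M>"
    and "\<N> \<in> tensors (Js @ Js)" and "hermitian_pos_def Js \<N>"
    and "\<L> \<in> tensors (Ks @ Ks)" and "hermitian_pos_def Ks \<L>"
  shows
    "weighted_mp_inverse Is Ks \<M> \<L> (\<A> \<star>\<^bsub>N\<^esub> \<B>) =
       weighted_mp_inverse Js Ks \<N> \<L> \<B> \<star>\<^bsub>N\<^esub> weighted_mp_inverse Is Js \<M> \<N> \<A>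
     \<longleftrightarrow>
       weighted_mp_inverse Is Js \<M> \<N> \<A> \<star>\<^bsub>M\<^esub> \<A> \<star>\<^bsub>N\<^esub> \<B>
           \<star>\<^bsub>L\<^esub> weighted_conj_transpose Js Ks \<N> \<L> \<B> \<star>\<^bsub>N\<^esub> weighted_conj_transpose Is Js \<M> \<N> \<A> =
         \<B> \<star>\<^bsub>L\<^esub> weighted_conj_transpose Js Ks \<N> \<L> \<B> \<star>\<^bsub>N\<^esub> weighted_conj_transpose Is Js \<M> \<N> \<A>
     \<and>
       conj_transpose M
           (\<M> \<star>\<^bsub>M\<^esub> \<A> \<star>\<^bsub>N\<^esub> \<B> \<star>\<^bsub>L\<^esub> weighted_mp_inverse Js Ks \<N> \<L> \<B>
              \<star>\<^bsub>N\<^esub> weighted_mp_inverse Is Js \<M> \<N> \<A>) =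
         \<M> \<star>\<^bsub>M\<^esub> \<A> \<star>\<^bsub>N\<^esub> \<B> \<star>\<^bsub>L\<^esub> weighted_mp_inverse Js Ks \<N> \<L> \<B>
           \<star>\<^bsub>N\<^esub> weighted_mp_inverse Is Js \<M> \<N> \<A>"
proof -
  obtain r r' where r: "local_inverse (unit_mat Is) r r'" "tensor_mat Is Is \<M> = adj r * r"
    using hermitian_pos_def_factorization[OF assms(7)] .
  obtain n n' where n: "local_inverse (unit_mat Js) n n'" "tensor_mat Js Js \<N> = adj n * n"
    using hermitian_pos_def_factorization[OF assms(9)] .
  obtain l l' where l: "local_inverse (unit_mat Ks) l l'" "tensor_mat Ks Ks \<L> = adj l * l"
    using hermitian_pos_def_factorization[OF assms(11)] .
  note len = assms(1-3)[symmetric] and A = assms(4) and B = assms(5)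
    and M = assms(6) and N = assms(8) and L = assms(10)
  have AB: "\<A> \<star>\<^bsub>length Js\<^esub> \<B> \<in> tensors (Is @ Ks)"
    using A B by (rule einstein_in_tensors)
  define X Y where "X = weighted_mp_inverse Is Js \<M> \<N> \<A>"
    and "Y = weighted_mp_inverse Js Ks \<N> \<L> \<B>"
  have X: "X \<in> tensors (Js @ Is)"
    and mpX: "is_mp_inverse_wrt (adj r * r) (adj n * n) (tensor_mat Is Js \<A>) (tensor_mat Js Is X)"
    unfolding X_def by (rule weighted_mp_inverse[OF A M N r n])+
  have Y: "Y \<in> tensors (Ks @ Js)"
    and mpY: "is_mp_inverse_wrt (adj n * n) (adj l * l) (tensor_mat Js Ks \<B>) (tensor_mat Ks Js Y)"
    unfolding Y_def by (rule weighted_mp_inverse[OF B N L n l])+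
  define A' B' where "A' = weighted_conj_transpose Is Js \<M> \<N> \<A>"
    and "B' = weighted_conj_transpose Js Ks \<N> \<L> \<B>"
  note inv = tensor_inverse[OF N n] tensor_inverse[OF L l]
  note typing = einstein_in_tensors conj_transpose_in_tensors inv A B M N L X Y
  have A': "A' \<in> tensors (Js @ Is)"
    "tensor_mat Js Is A' = n' * adj n' * adj (tensor_mat Is Js \<A>) * (adj r * r)"
    by (simp_all add: A'_def weighted_conj_transpose_def tensor_mat_einstein tensor_mat_conj_transpose typing r)
  have B': "B' \<in> tensors (Ks @ Js)"
    "tensor_mat Ks Js B' = l' * adj l' * adj (tensor_mat Js Ks \<B>) * (adj n * n)"
    by (simp_all add: B'_def weighted_conj_transpose_def tensor_mat_einstein tensor_mat_conj_transpose typing n)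
  \<comment> \<open>By uniqueness, the reverse order equation says that the product of
    \<open>Y\<close> and \<open>X\<close> satisfies the Penrose equations; these are moved to the
    ring, and the resulting conditions are moved back.\<close>
  have "weighted_mp_inverse Is Ks \<M> \<L> (\<A> \<star>\<^bsub>N\<^esub> \<B>) = Y \<star>\<^bsub>N\<^esub> X \<longleftrightarrow>
      is_weighted_mp_inverse Is Ks \<M> \<L> (\<A> \<star>\<^bsub>N\<^esub> \<B>) (Y \<star>\<^bsub>N\<^esub> X)"
    unfolding len weighted_mp_inverse(1)[OF AB M L r l] by auto
  also have "\<dots> \<longleftrightarrow> is_mp_inverse_wrt (adj r * r) (adj l * l)
      (tensor_mat Is Js \<A> * tensor_mat Js Ks \<B>) (tensor_mat Ks Js Y * tensor_mat Js Is X)"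
    unfolding len by (subst is_weighted_mp_inverse_iff[OF AB M L]) (simp_all add: typing tensor_mat_einstein r l)
  also have "\<dots> \<longleftrightarrow>
      tensor_mat Js Is X * tensor_mat Is Js \<A> * tensor_mat Js Ks \<B> * tensor_mat Ks Js B' * tensor_mat Js Is A' =
        tensor_mat Js Ks \<B> * tensor_mat Ks Js B' * tensor_mat Js Is A' \<and>
      adj (adj r * r * tensor_mat Is Js \<A> * tensor_mat Js Ks \<B> * tensor_mat Ks Js Y * tensor_mat Js Is X) =
        adj r * r * tensor_mat Is Js \<A> * tensor_mat Js Ks \<B> * tensor_mat Ks Js Y * tensor_mat Js Is X"
    by (rule weighted_reverse_order_law[OF r(1) n(1) l(1) _ _ _ _ _ _ _ _ mpX mpY A'(2) B'(2)]) simp_all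
  also have "\<dots> \<longleftrightarrow> X \<star>\<^bsub>M\<^esub> \<A> \<star>\<^bsub>N\<^esub> \<B> \<star>\<^bsub>L\<^esub> B' \<star>\<^bsub>N\<^esub> A' = \<B> \<star>\<^bsub>L\<^esub> B' \<star>\<^bsub>N\<^esub> A' \<and>
      conj_transpose M (\<M> \<star>\<^bsub>M\<^esub> \<A> \<star>\<^bsub>N\<^esub> \<B> \<star>\<^bsub>L\<^esub> Y \<star>\<^bsub>N\<^esub> X) = \<M> \<star>\<^bsub>M\<^esub> \<A> \<star>\<^bsub>N\<^esub> \<B> \<star>\<^bsub>L\<^esub> Y \<star>\<^bsub>N\<^esub> X"
    by (simp add: len tensor_mat_eq_iff[of _ Js Is, symmetric] tensor_mat_eq_iff[of _ Is Is, symmetric]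
        tensor_mat_einstein tensor_mat_conj_transpose typing A'(1) B'(1) r)
  finally show ?thesis
    unfolding X_def Y_def A'_def B'_def .
qed

end
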